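(* Let $k\ge1$ be an integer, $a\in\mathbb{R}$, and $\mathfrak{S}=\{x\in\mathbb{C}: -1\le \operatorname{Im}(x)\le 0\}$. Let $F$ be a complex function analytic on an open set containing $\{a\,x(x+i): x\in\mathfrak{S}\}$ such that $F(a\,x(x+i))=o\!\left(e^{\pi|x|}/|x|\right)$ uniformly for $x\in\mathfrak{S}$ as $\operatorname{Re}(x)\to\pm\infty$. Then $$\int_{-\infty}^{\infty}\frac{F(a\,x(x+i))}{\cosh(\pi(2k-1)x)}\,dx=(-1)^{k+1}\frac{F(a/4)}{2k-1}-\frac{2(-1)^k}{2k-1}\sum_{n=1}^{k-1}(-1)^nF\!\left(\frac{a\,\big((2k-1)^2-4n^2\big)}{4(2k-1)^2}\right).$$
   Context: The integral over the real line is understood as $\lim_{R\to\infty}\int_{-R}^{R}$. An empty sum is $0$. *)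

theory Defs
  imports "HOL-Complex_Analysis.Complex_Analysis" "HOL-Library.Landau_Symbols"
begin

definition strip :: "complex set" where
  "strip = {x. -1 \<le> Im x \<and> Im x \<le> 0}"

text \<open>
  Re x tends to plus or minus infinity with x in the strip; an asymptotic relation along this
  filter is uniform in Im x.
\<close>
definition strip_ends :: "complex filter" where
  "strip_ends = inf (filtercomap (\<lambda>x. \<bar>Re x\<bar>) at_top) (principal strip)"

text \<open>
  The integral over the real line as the limit of the integrals over symmetric intervals.
  Integrability is demanded explicitly because \<^const>\<open>integral\<close> is 0 on non-integrable functions.
\<close>
definition has_symmetric_integral :: "(real \<Rightarrow> complex) \<Rightarrow> complex \<Rightarrow> bool" where
  "has_symmetric_integral f I \<longleftrightarrow>
     (\<forall>R. f integrable_on {-R..R}) \<and> ((\<lambda>R. integral {-R..R} f) \<longlongrightarrow> I) at_top"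

end

theory Submission
  imports Defs
begin

text \<open>
  Put \<open>m = 2k - 1\<close>, \<open>f x = F (a x (x + \<i>))\<close> and \<open>g x = f x / cosh (\<pi> m x)\<close>. The point
  reflection \<open>x \<mapsto> -\<i> - x\<close> maps the strip \<open>-1 \<le> Im x \<le> 0\<close> to itself and exchanges its two
  boundary lines. It leaves \<open>x (x + \<i>)\<close>, hence \<open>f\<close>, unchanged, and because \<open>m\<close> is odd it changes
  the sign of \<open>cosh (\<pi> m x)\<close>; so \<open>g\<close> is odd under the reflection. Opposite sides of the rectangle
  with corners \<open>-R - \<i>\<close> and \<open>R\<close> therefore contribute equally to the integral of \<open>g\<close> along its
  boundary (\<open>contour_integral_rectpath_of_reflection_odd\<close>), and the residue theorem expresses
  twice the integral over \<open>[-R, R]\<close> by the residues inside and twice the integral over the right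
  side (\<open>integral_over_cosh_eq_residues\<close>).

  The growth condition says that \<open>f\<close> is of smaller order than \<open>e\<^sup>\<pi>\<^sup>R\<close> on the right side, where
  \<open>cosh (\<pi> m x)\<close> has modulus at least a constant times \<open>e\<^sup>\<pi>\<^sup>R\<close>. The side has length 1, so its
  contribution vanishes as \<open>R \<longlongrightarrow> \<infinity>\<close> (\<open>tendsto_right_side_integral\<close>).

  What remains are the \<open>m\<close> simple zeros \<open>-\<i> y\<close> of \<open>cosh (\<pi> m x)\<close> in the strip, \<open>y = (2j + 1) / (2m)\<close>, where \<open>f\<close> has the value
  \<open>F (a y (1 - y))\<close>. These zeros lie symmetrically about \<open>-\<i> / 2\<close>. Writing \<open>y = 1/2 + n/m\<close> turns
  \<open>y (1 - y)\<close> into \<open>(m\<^sup>2 - 4 n\<^sup>2) / (4 m\<^sup>2)\<close>: the middle one gives \<open>F (a / 4)\<close>, and those for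
  \<open>n\<close> and \<open>-n\<close> give equal terms, which is where the factor 2 in front of the sum comes from.
\<close>

section \<open>Contour integrals under a point reflection\<close>

lemma contour_integral_linepath_reflect:
  "contour_integral (linepath (c - a) (c - b)) g = - contour_integral (linepath a b) (\<lambda>z. g (c - z))"
proof -
  have "linepath (c - a) (c - b) x = c - linepath a b x" for x
    by (simp add: linepath_def algebra_simps)
  then show ?thesis
    by (simp add: contour_integral_integral flip: integral_neg)
       (simp add: algebra_simps)
qed

text \<open>
  The point reflection \<open>z \<mapsto> p + q - z\<close> fixes the centre of the rectangle. It carries each side to
  the opposite one, in the direction in which the boundary is traversed; the sign from \<open>dz\<close>
  cancels the sign from \<open>g\<close>.
\<close>
lemma contour_integral_rectpath_of_reflection_odd:
  assumes cont: "continuous_on (path_image (rectpath p q)) g"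
    and le: "Re p \<le> Re q" "Im p \<le> Im q"
    and odd: "\<And>z. z \<in> path_image (rectpath p q) \<Longrightarrow> g (p + q - z) = - g z"
  shows "contour_integral (rectpath p q) g =
    2 * (contour_integral (linepath (Complex (Re q) (Im p)) q) g
         + contour_integral (linepath q (Complex (Re p) (Im q))) g)"
proof -
  define r s where "r = Complex (Re q) (Im p)" and "s = Complex (Re p) (Im q)"
  have sides: "closed_segment p r \<subseteq> path_image (rectpath p q)" "closed_segment r q \<subseteq> path_image (rectpath p q)"
    "closed_segment q s \<subseteq> path_image (rectpath p q)" "closed_segment s p \<subseteq> path_image (rectpath p q)"
    by (auto simp: rectpath_def Let_def path_image_join r_def s_def)
  have int: "g contour_integrable_on linepath p r" "g contour_integrable_on linepath r q"
    "g contour_integrable_on linepath q s" "g contour_integrable_on linepath s p"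
    using sides by (auto intro!: contour_integrable_continuous_linepath continuous_on_subset[OF cont])
  have reflect: "contour_integral (linepath (p + q - u) (p + q - v)) g = contour_integral (linepath u v) g"
    if "closed_segment u v \<subseteq> path_image (rectpath p q)" for u v
  proof -
    have "contour_integral (linepath u v) (\<lambda>z. g (p + q - z)) = contour_integral (linepath u v) (\<lambda>z. - g z)"
      using that odd by (intro contour_integral_cong) auto
    then show ?thesis
      by (simp add: contour_integral_linepath_reflect contour_integral_neg)
  qed
  have opp: "p + q - r = s" "p + q - s = r"
    by (auto simp: r_def s_def complex_eq_iff)
  have "contour_integral (linepath p r) g = contour_integral (linepath q s) g"
    using reflect[OF sides(3)] opp by simp
  moreover have "contour_integral (linepath s p) g = contour_integral (linepath r q) g"
    using reflect[OF sides(2)] opp by simp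
  moreover have "contour_integral (rectpath p q) g = contour_integral (linepath p r) g
      + contour_integral (linepath r q) g + contour_integral (linepath q s) g + contour_integral (linepath s p) g"
    using int by (simp add: rectpath_def Let_def flip: r_def s_def)
  ultimately show ?thesis
    by (simp flip: r_def s_def)
qed

section \<open>The poles of the integrand\<close>

text \<open>
  In contrast to \<open>residue_simple_pole_deriv\<close>, the numerator may vanish at the point,
  so that the singularity may be removable: the function \<open>F\<close> can have a zero at the image of a pole
  of \<open>1 / cosh\<close>.
\<close>
lemma residue_divide_simple_zero:
  assumes S: "open S" "z \<in> S" and f: "f holomorphic_on S" and g: "g holomorphic_on S"
    and nz: "\<And>w. w \<in> S - {z} \<Longrightarrow> g w \<noteq> 0" and "g z = 0"
    and g': "(g has_field_derivative g') (at z)" "g' \<noteq> 0"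
  shows "residue (\<lambda>w. f w / g w) z = f z / g'"
proof (rule residue_simple'[OF S])
  show "(\<lambda>w. f w / g w) holomorphic_on S - {z}"
    using f g nz by (intro holomorphic_on_divide) (auto intro: holomorphic_on_subset)
  have "(f \<longlongrightarrow> f z) (at z)"
    using f S by (metis continuous_on_eq_continuous_at holomorphic_on_imp_continuous_on isCont_def)
  moreover have "((\<lambda>w. g w / (w - z)) \<longlongrightarrow> g') (at z)"
    using g'(1) \<open>g z = 0\<close> by (simp add: has_field_derivative_iff)
  ultimately have "((\<lambda>w. f w / (g w / (w - z))) \<longlongrightarrow> f z / g') (at z)"
    using g'(2) by (intro tendsto_divide)
  then show "((\<lambda>w. f w / g w * (w - z)) \<longlongrightarrow> f z / g') (at z)"
    by (simp add: field_simps)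
qed

lemma cosh_of_real: "cosh (of_real x :: complex) = of_real (cosh x)"
  by (simp add: cosh_def exp_of_real scaleR_conv_of_real flip: of_real_minus)

lemma cosh_strip_reflect:
  assumes "odd m"
  shows "cosh (of_real (pi * real m) * (- \<i> - z)) = - cosh (of_real (pi * real m) * z)"
proof -
  have "cos (real m * pi) = -1" "sin (real m * pi) = 0"
    using assms by (simp_all add: cos_npi)
  then have "cos (of_real (pi * real m) :: complex) = -1" "sin (of_real (pi * real m) :: complex) = 0"
    by (simp_all add: cos_of_real sin_of_real mult.commute del: of_real_mult)
  moreover have "\<i> * (of_real (pi * real m) * (- \<i> - z)) =
      of_real (pi * real m) - \<i> * (of_real (pi * real m) * z)"
    by (simp add: algebra_simps)
  ultimately show ?thesis
    by (simp only: cosh_conv_cos cos_diff) simp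
qed

definition cosh_zero :: "nat \<Rightarrow> nat \<Rightarrow> complex" where
  "cosh_zero m j = Complex 0 (- ((2 * real j + 1) / (2 * real m)))"

lemma cosh_sinh_at_cosh_zero:
  assumes "m > 0"
  shows "cosh (of_real (pi * real m) * cosh_zero m j) = 0"
    and "sinh (of_real (pi * real m) * cosh_zero m j) = - \<i> * (-1) ^ j"
proof -
  have eq: "\<i> * (of_real (pi * real m) * cosh_zero m j) = of_real (real j * pi + pi / 2)"
    using assms by (simp add: cosh_zero_def complex_eq_iff field_simps)
  have "cos (real j * pi + pi / 2) = 0" "sin (real j * pi + pi / 2) = (-1) ^ j"
    by (simp_all add: cos_add sin_add)
  then show "cosh (of_real (pi * real m) * cosh_zero m j) = 0"
    and "sinh (of_real (pi * real m) * cosh_zero m j) = - \<i> * (-1) ^ j"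
    unfolding cosh_conv_cos sinh_conv_sin eq cos_of_real sin_of_real by simp_all
qed

text \<open>
  The residue theorem needs an open set around the closed strip. The next zeros of
  \<open>cosh (\<pi> m z)\<close> above and below the strip are at distance \<open>1 / (2m)\<close> from it, so a margin of that
  size admits no further poles.
\<close>
lemma cosh_zeros_near_strip:
  assumes "m > 0" and zero: "cosh (of_real (pi * real m) * z) = 0"
    and Im: "-1 - 1 / (2 * real m) < Im z" "Im z < 1 / (2 * real m)"
  shows "z \<in> cosh_zero m ` {..<m}"
proof -
  obtain n :: int where "\<i> * (of_real (pi * real m) * z) = of_real (n * pi) + of_real pi / 2"
    using zero unfolding cosh_conv_cos cos_eq_0 by blast
  then have *: "pi * (real m * Im z) = - pi * (of_int n + 1 / 2)" "Re z = 0"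
    using \<open>m > 0\<close> by (auto simp: complex_eq_iff algebra_simps)
  then have Im_eq: "real m * Im z = - (of_int n + 1 / 2)"
    by (metis mult_cancel_left mult_minus_left mult_minus_right pi_neq_zero)
  have "real m * Im z < 1 / 2" "- real m - 1 / 2 < real m * Im z"
    using Im \<open>m > 0\<close> by (simp_all add: field_simps)
  then have "0 \<le> n" "n < int m"
    using Im_eq by linarith+
  moreover have "z = cosh_zero m (nat n)"
    using * Im_eq \<open>m > 0\<close> \<open>0 \<le> n\<close> by (simp add: cosh_zero_def complex_eq_iff field_simps)
  ultimately show ?thesis
    by auto
qed

section \<open>The integral over a symmetric interval\<close>

lemma integral_over_cosh_eq_residues:
  fixes f :: "complex \<Rightarrow> complex"
  assumes "odd m" and V: "open V" "strip \<subseteq> V" and f: "f holomorphic_on V"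
    and sym: "\<And>z. z \<in> strip \<Longrightarrow> f (- \<i> - z) = f z" and "R > 0"
  defines "g \<equiv> \<lambda>z. f z / cosh (of_real (pi * real m) * z)"
  shows "integral {-R..R} (\<lambda>x. g (of_real x)) =
    (\<Sum>j<m. (-1) ^ j * f (cosh_zero m j)) / of_nat m
    + contour_integral (linepath (Complex R (-1)) (of_real R)) g"
proof -
  define h where "h = (\<lambda>z::complex. cosh (of_real (pi * real m) * z))"
  define pts where "pts = cosh_zero m ` {..<m}"
  define p q where "p = Complex (-R) (-1)" and "q = complex_of_real R"
  have "m > 0"
    using \<open>odd m\<close> by (simp add: odd_pos)
  define W where "W = V \<inter> {z. -1 - 1 / (2 * real m) < Im z} \<inter> {z. Im z < 1 / (2 * real m)}"
  have "open W"
    using V unfolding W_def by (intro open_Int open_halfspace_Im_gt open_halfspace_Im_lt) auto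
  have "strip \<subseteq> W"
  proof
    fix z assume z: "z \<in> strip"
    moreover have "0 < 1 / (2 * real m)"
      using \<open>m > 0\<close> by simp
    ultimately have "-1 - 1 / (2 * real m) < Im z" "Im z < 1 / (2 * real m)"
      unfolding strip_def mem_Collect_eq by linarith+
    then show "z \<in> W"
      using z V(2) by (auto simp: W_def)
  qed
  \<comment> \<open>\<open>V\<close> and \<open>W\<close> may be disconnected; the residue theorem is applied on the component of the strip.\<close>
  define S where "S = connected_component_set W 0"
  have "convex strip"
    unfolding strip_def Collect_conj_eq
    using convex_halfspace_Im_ge[of "-1"] convex_halfspace_Im_le[of 0] by (simp add: convex_Int)
  have S: "open S" "connected S" "S \<subseteq> W" "strip \<subseteq> S"
    using \<open>open W\<close> connected_component_maximal[of 0 strip W] \<open>strip \<subseteq> W\<close>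
      convex_connected[OF \<open>convex strip\<close>]
    by (simp_all add: S_def open_connected_component connected_component_subset, simp add: strip_def)
  have h_zero: "z \<in> pts" if "z \<in> S" "h z = 0" for z
    using that S(3) cosh_zeros_near_strip[OF \<open>m > 0\<close>, of z] by (auto simp: W_def h_def pts_def)
  have h_pts: "h z = 0" if "z \<in> pts" for z
    using that cosh_sinh_at_cosh_zero(1)[OF \<open>m > 0\<close>] by (auto simp: pts_def h_def)
  have Im_pts: "-1 < Im (cosh_zero m j)" "Im (cosh_zero m j) < 0" "Re (cosh_zero m j) = 0" if "j < m" for j
    using that by (auto simp: cosh_zero_def field_simps)
  have pts_box: "pts \<subseteq> box p q"
    using Im_pts \<open>R > 0\<close> by (auto simp: pts_def in_box_complex_iff p_def q_def)
  have "inj_on (cosh_zero m) {..<m}"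
    using \<open>m > 0\<close> by (auto simp: inj_on_def cosh_zero_def)
  have le: "Re p \<le> Re q" "Im p \<le> Im q"
    using \<open>R > 0\<close> by (auto simp: p_def q_def)
  have cbox_strip: "cbox p q \<subseteq> strip"
    by (auto simp: in_cbox_complex_iff p_def q_def strip_def)
  then have path_S: "path_image (rectpath p q) \<subseteq> S - pts"
    using path_image_rectpath_cbox_minus_box[OF le] pts_box S(4) by auto
  have fh: "f holomorphic_on S" "h holomorphic_on S"
    using f S(3) unfolding h_def
    by (auto simp: W_def cosh_conv_cos intro!: holomorphic_intros elim: holomorphic_on_subset)
  have g: "g = (\<lambda>z. f z / h z)"
    by (simp add: g_def h_def)
  have g_holo: "g holomorphic_on S - pts"
    unfolding g using fh h_zero by (intro holomorphic_on_divide) (auto intro: holomorphic_on_subset)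
  have cont: "continuous_on (path_image (rectpath p q)) g"
    using g_holo path_S by (meson continuous_on_subset holomorphic_on_imp_continuous_on)

  have res: "residue g (cosh_zero m j) = \<i> * ((-1) ^ j * f (cosh_zero m j)) / of_real (pi * real m)"
    if "j < m" for j
  proof -
    let ?z = "cosh_zero m j" and ?c = "complex_of_real (pi * real m)"
    have "?z \<in> S" "?z \<in> pts"
      using that S(4) cbox_strip pts_box box_subset_cbox by (auto simp: pts_def) blast
    have "residue g ?z = f ?z / (sinh (?c * ?z) * ?c)"
      unfolding g
    proof (rule residue_divide_simple_zero)
      show "open (S - (pts - {?z}))"
        using S(1) by (intro open_Diff finite_imp_closed) (auto simp: pts_def)
      show "(h has_field_derivative sinh (?c * ?z) * ?c) (at ?z)"
        unfolding h_def by (auto intro!: derivative_eq_intros)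
      show "sinh (?c * ?z) * ?c \<noteq> 0"
        unfolding cosh_sinh_at_cosh_zero(2)[OF \<open>m > 0\<close>] using \<open>m > 0\<close> by simp
    qed (use fh h_zero h_pts \<open>?z \<in> S\<close> \<open>?z \<in> pts\<close> in \<open>auto intro: holomorphic_on_subset\<close>)
    also have "\<dots> = \<i> * ((-1) ^ j * f ?z) / ?c"
      unfolding cosh_sinh_at_cosh_zero(2)[OF \<open>m > 0\<close>]
      using \<open>m > 0\<close> by (cases "even j") (simp_all add: field_simps)
    finally show ?thesis .
  qed
  have "contour_integral (rectpath p q) g = 2 * pi * \<i> * (\<Sum>z\<in>pts. winding_number (rectpath p q) z * residue g z)"
  proof (rule Residue_theorem)
    show "\<forall>z. z \<notin> S \<longrightarrow> winding_number (rectpath p q) z = 0"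
      using le cbox_strip S(4) by (auto intro!: winding_number_rectpath_outside)
  qed (use S g_holo path_S in \<open>auto simp: pts_def\<close>)
  also have "(\<Sum>z\<in>pts. winding_number (rectpath p q) z * residue g z) = (\<Sum>z\<in>pts. residue g z)"
    using pts_box by (intro sum.cong) (auto simp: winding_number_rectpath)
  also have "\<dots> = (\<Sum>j<m. \<i> * ((-1) ^ j * f (cosh_zero m j)) / of_real (pi * real m))"
    unfolding pts_def by (simp add: sum.reindex[OF \<open>inj_on _ _\<close>] res)
  also have "\<dots> = \<i> * (\<Sum>j<m. (-1) ^ j * f (cosh_zero m j)) / of_real (pi * real m)"
    by (simp add: sum_divide_distrib sum_distrib_left)
  finally have J: "contour_integral (rectpath p q) g
      = - 2 * ((\<Sum>j<m. (-1) ^ j * f (cosh_zero m j)) / of_nat m)"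
    by simp
  have "p + q = - \<i>"
    by (simp add: p_def q_def complex_eq_iff)
  have "contour_integral (rectpath p q) g = 
    2 * (contour_integral (linepath (Complex (Re q) (Im p)) q) g
         + contour_integral (linepath q (Complex (Re p) (Im q))) g)"
  proof (rule contour_integral_rectpath_of_reflection_odd[OF cont le])
    fix z assume "z \<in> path_image (rectpath p q)"
    then have "z \<in> strip"
      using path_image_rectpath_subset_cbox[OF le] cbox_strip by auto
    then show "g (p + q - z) = - g z"
      unfolding \<open>p + q = - \<i>\<close> g_def cosh_strip_reflect[OF \<open>odd m\<close>] sym[OF \<open>z \<in> strip\<close>] by simp
  qed
  also have "Complex (Re p) (Im q) = of_real (-R)"
    by (simp add: p_def q_def complex_eq_iff)
  also have "contour_integral (linepath q (of_real (-R))) g = - contour_integral (linepath (of_real (-R)) q) g"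
  proof (rule contour_integral_reverse_linepath, rule continuous_on_subset[OF cont])
    show "closed_segment q (of_real (-R)) \<subseteq> path_image (rectpath p q)"
      using \<open>R > 0\<close> unfolding path_image_rectpath[OF le]
      by (auto simp: p_def q_def closed_segment_same_Im closed_segment_eq_real_ivl)
  qed
  also have "contour_integral (linepath (of_real (-R)) q) g = integral {-R..R} (\<lambda>x. g (of_real x))"
    using contour_integral_linepath_Reals_eq[of "of_real (-R)" q g] \<open>R > 0\<close> by (simp add: q_def)
  finally have eq: "- 2 * ((\<Sum>j<m. (-1) ^ j * f (cosh_zero m j)) / of_nat m) =
      2 * (contour_integral (linepath (Complex R (-1)) (of_real R)) g
           + - integral {-R..R} (\<lambda>x. g (of_real x)))"
    unfolding J by (simp add: p_def q_def)
  have "I = T + C" if "- 2 * T = 2 * (C + - I)" for I T C :: complex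
  proof -
    have "2 * I = 2 * (T + C)"
      using that by (simp add: algebra_simps)
    then show ?thesis
      by (metis mult_cancel_left zero_neq_numeral)
  qed
  from this[OF eq] show ?thesis .
qed

section \<open>The contribution of the vertical sides\<close>

lemma norm_cosh_ge_sinh: "sinh (Re z) \<le> norm (cosh z)"
proof -
  have "norm (exp z) - norm (exp (- z)) \<le> norm (exp z + exp (- z))"
    by norm
  then show ?thesis
    by (simp add: cosh_def sinh_def norm_divide)
qed

text \<open>
  The case \<open>m = 1\<close> is the critical one: there \<open>cosh\<close> has exactly the exponential growth permitted
  to \<open>f\<close>. Larger \<open>m\<close> only increase the denominator.
\<close>
lemma tendsto_right_side_integral:
  fixes f :: "complex \<Rightarrow> complex"
  assumes "m \<ge> 1" and f: "continuous_on strip f"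
    and small: "f \<in> o[strip_ends](\<lambda>x. of_real (exp (pi * norm x) / norm x))"
  shows "((\<lambda>R. contour_integral (linepath (Complex R (-1)) (of_real R))
            (\<lambda>z. f z / cosh (of_real (pi * real m) * z))) \<longlongrightarrow> 0) at_top"
proof (rule tendstoI)
  fix e :: real assume "e > 0"
  \<comment> \<open>The factor \<open>exp pi\<close> absorbs \<open>norm z \<le> R + 1\<close>, a factor 4 the lower bound for \<open>cosh\<close>, and a
    factor 2 makes the final inequality strict.\<close>
  define c where "c = e / (8 * exp pi)"
  have "c > 0"
    using \<open>e > 0\<close> by (simp add: c_def)
  have "eventually (\<lambda>z. norm (f z) \<le> c * norm (complex_of_real (exp (pi * norm z) / norm z))) strip_ends"
    using landau_o.smallD[OF small \<open>c > 0\<close>] .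
  then obtain B where B: "\<And>z. z \<in> strip \<Longrightarrow> \<bar>Re z\<bar> \<ge> B \<Longrightarrow>
      norm (f z) \<le> c * norm (complex_of_real (exp (pi * norm z) / norm z))"
    unfolding strip_ends_def eventually_inf_principal eventually_filtercomap eventually_at_top_linorder
    by blast
  show "eventually (\<lambda>R. dist (contour_integral (linepath (Complex R (-1)) (of_real R))
            (\<lambda>z. f z / cosh (of_real (pi * real m) * z))) 0 < e) at_top"
    using eventually_ge_at_top[of "max B 1"]
  proof eventually_elim
    case (elim R)
    then have R: "R \<ge> B" "R \<ge> 1"
      by auto
    have seg: "z \<in> strip" "Re z = R" if "z \<in> closed_segment (Complex R (-1)) (of_real R)" for z
      using that by (auto simp: closed_segment_same_Re closed_segment_eq_real_ivl strip_def)
    have cosh_ge: "exp (pi * R) / 4 \<le> norm (cosh (of_real (pi * real m) * z))" if "Re z = R" for z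
    proof -
      have "1 \<le> pi * R"
        using R pi_ge_two mult_mono[of 1 pi 1 R] by simp
      then have "2 * exp (- (pi * R)) \<le> 2"
        by simp
      also have "\<dots> \<le> exp (1::real)"
        using exp_ge_add_one_self[of 1] by simp
      also have "\<dots> \<le> exp (pi * R)"
        using \<open>1 \<le> pi * R\<close> by simp
      finally have "exp (pi * R) / 4 \<le> sinh (pi * R)"
        by (simp add: sinh_def)
      also have "\<dots> \<le> sinh (pi * real m * R)"
        using \<open>m \<ge> 1\<close> R by (simp add: sinh_real_le_iff mult_le_cancel_right1)
      also have "\<dots> = sinh (Re (of_real (pi * real m) * z))"
        using that by simp
      also have "\<dots> \<le> norm (cosh (of_real (pi * real m) * z))"
        by (rule norm_cosh_ge_sinh)
      finally show ?thesis .
    qed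
    have bound: "norm (f z / cosh (of_real (pi * real m) * z)) \<le> e / 2"
      if "z \<in> closed_segment (Complex R (-1)) (of_real R)" for z
    proof -
      note z = seg[OF that]
      have "R \<le> norm z"
        using z abs_Re_le_cmod[of z] by linarith
      have "norm z \<le> R + 1"
        using z R cmod_le[of z] by (auto simp: strip_def)
      have "norm (f z) \<le> c * (exp (pi * norm z) / norm z)"
        using B[of z] z R by (simp add: norm_divide)
      also have "\<dots> \<le> c * (exp (pi * (R + 1)) / 1)"
        using \<open>c > 0\<close> \<open>R \<le> norm z\<close> \<open>norm z \<le> R + 1\<close> R
        by (intro mult_left_mono frac_le) auto
      also have "\<dots> = e / 2 * (exp (pi * R) / 4)"
        by (simp add: c_def exp_add algebra_simps)
      finally have "norm (f z) \<le> e / 2 * (exp (pi * R) / 4)" .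
      also have "\<dots> \<le> e / 2 * norm (cosh (of_real (pi * real m) * z))"
        using cosh_ge[OF z(2)] \<open>e > 0\<close> by (intro mult_left_mono) auto
      finally have "norm (f z) \<le> e / 2 * norm (cosh (of_real (pi * real m) * z))" .
      moreover have "norm (cosh (of_real (pi * real m) * z)) > 0"
        using cosh_ge[OF z(2)] by (smt (verit) exp_gt_zero divide_pos_pos)
      ultimately show ?thesis
        unfolding norm_divide by (subst pos_divide_le_eq)
    qed
    have "continuous_on (closed_segment (Complex R (-1)) (of_real R)) (\<lambda>z. f z / cosh (of_real (pi * real m) * z))"
    proof (intro continuous_intros)
      show "continuous_on (closed_segment (Complex R (-1)) (of_real R)) f"
        using seg(1) by (intro continuous_on_subset[OF f]) auto
      show "\<forall>z\<in>closed_segment (Complex R (-1)) (of_real R). cosh (of_real (pi * real m) * z) \<noteq> 0"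
        using cosh_ge seg(2) by (smt (verit) exp_gt_zero divide_pos_pos norm_zero)
    qed
    then have "norm (contour_integral (linepath (Complex R (-1)) (of_real R))
            (\<lambda>z. f z / cosh (of_real (pi * real m) * z))) \<le> e / 2 * norm (of_real R - Complex R (-1))"
      using bound \<open>e > 0\<close>
      by (intro contour_integral_bound_linepath contour_integrable_continuous_linepath) auto
    also have "of_real R - Complex R (-1) = \<i>"
      by (simp add: complex_eq_iff)
    finally show ?case
      using \<open>e > 0\<close> by simp
  qed
qed

section \<open>Evaluation of the residues\<close>

lemma sum_symmetric_about_middle:
  fixes t :: "int \<Rightarrow> complex"
  assumes "k \<ge> 1" and even: "\<And>n. t (- n) = t n"
  shows "(\<Sum>j<2 * k - 1. t (int j - int (k - 1))) = t 0 + 2 * (\<Sum>n = 1..k - 1. t (int n))"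
proof -
  define l where "l = k - 1"
  have "(\<Sum>j<2 * k - 1. t (int j - int l)) = (\<Sum>n = - int l..int l. t n)"
    by (rule sum.reindex_bij_witness[where i = "\<lambda>n. nat (n + int l)" and j = "\<lambda>j. int j - int l"])
       (use \<open>k \<ge> 1\<close> in \<open>auto simp: l_def\<close>)
  also have "\<dots> = t 0 + 2 * (\<Sum>n = 1..l. t (int n))"
  proof (induction l)
    case (Suc l)
    have "{- int (Suc l)..int (Suc l)} = insert (int (Suc l)) (insert (- int (Suc l)) {- int l..int l})"
      by auto
    then show ?case
      using Suc even[of "int (Suc l)"] by (simp add: algebra_simps)
  qed simp
  finally show ?thesis
    by (simp add: l_def)
qed

theorem mainTheorem9:
  fixes k :: nat and a :: real and F :: "complex \<Rightarrow> complex" and U :: "complex set"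
  assumes "k \<ge> 1"
    and "open U"
    and "(\<lambda>x. of_real a * x * (x + \<i>)) ` strip \<subseteq> U"
    and "F analytic_on U"
    and "(\<lambda>x. F (of_real a * x * (x + \<i>)))
           \<in> o[strip_ends](\<lambda>x. of_real (exp (pi * norm x) / norm x))"
  shows "has_symmetric_integral
     (\<lambda>x. F (of_real a * of_real x * (of_real x + \<i>)) / of_real (cosh (pi * (2 * real k - 1) * x)))
     ((-1) ^ (k + 1) * F (of_real (a / 4)) / of_real (2 * real k - 1)
       - 2 * (-1) ^ k / of_real (2 * real k - 1)
         * (\<Sum>n = 1..k - 1. (-1) ^ n *
              F (of_real (a * ((2 * real k - 1)\<^sup>2 - 4 * (real n)\<^sup>2) / (4 * (2 * real k - 1)\<^sup>2)))))"
    (is "has_symmetric_integral ?G ?I")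
proof -
  define m where "m = 2 * k - 1"
  have m: "odd m" "m \<ge> 1" "real m = 2 * real k - 1"
    using \<open>k \<ge> 1\<close> by (auto simp: m_def)
  define w where "w = (\<lambda>x::complex. of_real a * x * (x + \<i>))"
  define f where "f = (\<lambda>x. F (w x))"
  define V where "V = w -` U"
  have "continuous_on UNIV w"
    unfolding w_def by (intro continuous_intros)
  then have V: "open V" "strip \<subseteq> V"
    using assms(2,3) by (auto simp: V_def w_def intro: open_vimage)
  have f_holo: "f holomorphic_on V"
  proof -
    have "w holomorphic_on V"
      unfolding w_def by (intro holomorphic_intros)
    then show ?thesis
      using holomorphic_on_compose_gen[of w V F U] analytic_imp_holomorphic[OF assms(4)]
      by (auto simp: f_def comp_def V_def)
  qed
  have sym: "f (- \<i> - z) = f z" for z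
    by (simp add: f_def w_def algebra_simps)
  have G: "?G = (\<lambda>x. f (of_real x) / cosh (of_real (pi * real m) * of_real x))"
    unfolding f_def w_def m(3) of_real_mult[symmetric] cosh_of_real by simp
  \<comment> \<open>The residue terms indexed by the signed distance from the middle pole \<open>j = k - 1\<close>.\<close>
  define t where "t = (\<lambda>n::int. (-1) ^ nat \<bar>n\<bar> *
      F (of_real (a * ((2 * real k - 1)\<^sup>2 - 4 * (of_int n)\<^sup>2) / (4 * (2 * real k - 1)\<^sup>2))))"
  have residue_term: "(-1) ^ j * f (cosh_zero m j) = (-1) ^ (k + 1) * t (int j - int (k - 1))" for j
  proof -
    have "w (cosh_zero m j) = of_real (a * ((real m)\<^sup>2 - 4 * (of_int (int j - int (k - 1)))\<^sup>2) / (4 * (real m)\<^sup>2))"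
    proof -
      define d y where "d = real_of_int (int j - int (k - 1))" and "y = 1 / 2 + d / real m"
      have "2 * d = 2 * real j + 1 - real m"
        using m \<open>k \<ge> 1\<close> by (simp add: d_def of_nat_diff)
      then have "cosh_zero m j = Complex 0 (- y)"
        using m(2) by (simp add: cosh_zero_def y_def field_simps)
      then have "w (cosh_zero m j) = of_real (a * (y * (1 - y)))"
        by (simp add: w_def complex_eq_iff algebra_simps)
      also have "a * (y * (1 - y)) = a * ((real m)\<^sup>2 - 4 * d\<^sup>2) / (4 * (real m)\<^sup>2)"
        using m(2) by (simp add: y_def field_simps power2_eq_square)
      finally show ?thesis
        by (simp only: d_def)
    qed
    moreover have "(-1) ^ j = (-1) ^ (k + 1) * (-1 :: complex) ^ nat \<bar>int j - int (k - 1)\<bar>"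
    proof -
      have "even j \<longleftrightarrow> even (k + 1 + nat \<bar>int j - int (k - 1)\<bar>)"
      proof (cases "k - 1 \<le> j")
        case True
        then obtain d where "j = k - 1 + d"
          using le_Suc_ex by blast
        then show ?thesis
          using \<open>k \<ge> 1\<close> by (cases k) auto
      next
        case False
        then obtain d where "k - 1 = j + d"
          using le_Suc_ex[of j "k - 1"] by auto
        then have "k = j + d + 1"
          using \<open>k \<ge> 1\<close> by simp
        then show ?thesis
          by simp blast
      qed
      then show ?thesis
        unfolding power_add[symmetric] by (simp only: minus_one_power_iff)
    qed
    ultimately show ?thesis
      by (simp add: f_def t_def m(3))
  qed
  have "(\<Sum>j<m. (-1) ^ j * f (cosh_zero m j)) = (-1) ^ (k + 1) * (t 0 + 2 * (\<Sum>n = 1..k - 1. t (int n)))"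
  proof -
    have "t (- n) = t n" for n
      by (simp add: t_def)
    then show ?thesis
      unfolding residue_term sum_distrib_left[symmetric] unfolding m_def
      by (simp only: sum_symmetric_about_middle[OF \<open>k \<ge> 1\<close>])
  qed
  moreover have "t 0 = F (of_real (a / 4))"
    using m by (simp add: t_def flip: m(3))
  moreover have "(\<Sum>n = 1..k - 1. t (int n)) = (\<Sum>n = 1..k - 1. (-1) ^ n *
              F (of_real (a * ((2 * real k - 1)\<^sup>2 - 4 * (real n)\<^sup>2) / (4 * (2 * real k - 1)\<^sup>2))))"
    by (simp add: t_def)
  moreover have "of_nat m = complex_of_real (2 * real k - 1)"
    by (simp flip: m(3))
  moreover have "(-1) ^ (k + 1) * (A + 2 * B) / C = (-1) ^ (k + 1) * A / C - 2 * (-1) ^ k / C * B"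
    for A B C :: complex
    by (simp add: distrib_left diff_divide_distrib)
  ultimately have I: "(\<Sum>j<m. (-1) ^ j * f (cosh_zero m j)) / of_nat m = ?I"
    by (simp only:)
  have "continuous_on strip f"
    using f_holo V holomorphic_on_imp_continuous_on continuous_on_subset by blast
  have "continuous_on UNIV (\<lambda>x. f (of_real x))"
    by (rule continuous_on_compose2[OF \<open>continuous_on strip f\<close>]) (auto simp: strip_def intro!: continuous_intros)
  then have "continuous_on {-R..R} ?G" for R
    unfolding f_def w_def
    by (intro continuous_intros) (auto intro: continuous_on_subset)
  then have "?G integrable_on {-R..R}" for R
    by (rule integrable_continuous_real)
  moreover have "((\<lambda>R. integral {-R..R} ?G) \<longlongrightarrow> ?I) at_top"
  proof -
    have "((\<lambda>R. contour_integral (linepath (Complex R (-1)) (of_real R))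
            (\<lambda>z. f z / cosh (of_real (pi * real m) * z))) \<longlongrightarrow> 0) at_top"
      using tendsto_right_side_integral[OF m(2) \<open>continuous_on strip f\<close>] assms(5)
      by (simp add: f_def w_def)
    from tendsto_add[OF tendsto_const[of ?I] this, unfolded add_0_right]
    show ?thesis
    proof (rule Lim_transform_eventually)
      show "eventually (\<lambda>R. ?I + contour_integral (linepath (Complex R (-1)) (of_real R))
            (\<lambda>z. f z / cosh (of_real (pi * real m) * z)) = integral {-R..R} ?G) at_top"
        using eventually_gt_at_top[of 0]
        by eventually_elim
          (simp only: G I integral_over_cosh_eq_residues[OF m(1) V f_holo sym])
    qed
  qed
  ultimately show ?thesis
    unfolding has_symmetric_integral_def by blast
qed

end
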